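(* Let $d\in\mathbb{N}$ and let $\mathcal{F}_1,\dots,\mathcal{F}_{3d}$ be non-empty collections of axis-parallel boxes in $\mathbb{R}^d$ such that every colorful $3d$-tuple is $2$-pierceable. Then there exist $i\in[3d]$ and, for every $k\in[3d]$ with $k\neq i$, a box $F_k\in\mathcal{F}_k$ such that $\mathcal{F}_i\cup\{F_k: k\in[3d],\,k\neq i\}$ is $2$-pierceable.
   Context: An axis-parallel box in $\mathbb{R}^d$ is a set $[\alpha_1,\beta_1]\times\dots\times[\alpha_d,\beta_d]$ with $\alpha_j\le\beta_j$. A family is $2$-pierceable if some set of at most $2$ points meets every member. A colorful $3d$-tuple from $\mathcal{F}_1,\dots,\mathcal{F}_{3d}$ is a tuple $(C_1,\dots,C_{3d})$ with $C_j\in\mathcal{F}_{i_j}$ for pairwise distinct indices $i_j$ (one member from each family). *)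

theory Defs
  imports "HOL-Analysis.Analysis"
begin

definition axis_box :: "(real ^ 'n) set \<Rightarrow> bool" where
  "axis_box B \<longleftrightarrow> (\<exists>\<alpha> \<beta>. (\<forall>j. \<alpha> $ j \<le> \<beta> $ j) \<and>
      B = {x. \<forall>j. \<alpha> $ j \<le> x $ j \<and> x $ j \<le> \<beta> $ j})"

definition pierceable2 :: "'a set set \<Rightarrow> bool" where
  "pierceable2 \<F> \<longleftrightarrow> (\<exists>P. finite P \<and> card P \<le> 2 \<and> (\<forall>C\<in>\<F>. C \<inter> P \<noteq> {}))"

end

theory Submission
  imports Defs
begin

text \<open>
  In each coordinate take the smallest right endpoint \<open>a\<^sub>j\<close> and the largest left endpoint \<open>b\<^sub>j\<close> of a
  family of boxes. If two points pierce the family, they can be moved to opposite vertices of the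
  box spanned by \<open>a\<close> and \<open>b\<close>, so piercing means finding a sign pattern \<open>\<epsilon>\<close> on the coordinates, up to
  a global sign, that is compatible with every box. The patterns compatible with a family form an
  affine subspace over the field with two elements.

  If all families are finite, boxes are picked greedily, each from a new colour: at most \<open>2d\<close> boxes
  realise the extreme endpoints of the picked boxes and the remaining colours, and every further
  pick that restricts the set of patterns halves it, which can happen at most \<open>d - 1\<close> times. So a
  colour is left when no box of a remaining colour restricts the patterns any more, and any
  surviving pattern then pierces everything.

  For infinite families an extreme endpoint may be an infimum that is not attained. Such an endpoint
  is only reserved: it is matched injectively to a remaining colour containing boxes arbitrarily
  close to it. Alternating paths show that either some set of colours contains all colours that come
  close to the endpoints matched to it, and picking sufficiently close boxes realises these
  endpoints without affecting the patterns, or every remaining colour can be freed from the matching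
  and so is available for a pick.
\<close>

section \<open>Rematching along alternating paths\<close>

text \<open>\<open>U\<close> is the complement in \<open>R\<close> of a largest set of colours that
  rematching can free. A side matched into \<open>U\<close> admits no freeable colour: moving the
  side to such a colour would free its old colour as well.\<close>

lemma unmatched_exchange:
  fixes T :: "'s \<Rightarrow> 'k set"
  assumes fin: "finite R" and inj: "inj_on w M" and w: "\<And>s. s \<in> M \<Longrightarrow> w s \<in> T s \<inter> R"
  obtains U where "U \<subseteq> w ` M" "\<And>s. s \<in> M \<Longrightarrow> w s \<in> U \<Longrightarrow> T s \<inter> R \<subseteq> U"
    "\<And>k. k \<in> R - U \<Longrightarrow> \<exists>w'. inj_on w' M \<and> (\<forall>s\<in>M. w' s \<in> T s \<inter> R) \<and> k \<notin> w' ` M"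
proof -
  \<comment> \<open>The last conjunct keeps sides matched outside \<open>X\<close> in place, so such
    a side still occupies \<open>w s\<close> just before it is moved to a freed colour.\<close>
  define P where "P X \<longleftrightarrow> R - w ` M \<subseteq> X \<and> X \<subseteq> R \<and> (\<forall>k\<in>X. \<exists>w'. inj_on w' M \<and>
      (\<forall>s\<in>M. w' s \<in> T s \<inter> R) \<and> k \<notin> w' ` M \<and> (\<forall>s\<in>M. w s \<notin> X \<longrightarrow> w' s = w s))" for X
  have "P (R - w ` M)"
    unfolding P_def using inj w by auto
  moreover have "\<forall>X. P X \<longrightarrow> card X < Suc (card R)"
    unfolding P_def using card_mono[OF fin] by (simp add: less_Suc_eq_le)
  ultimately obtain X where X: "P X" and max: "\<And>Y. P Y \<Longrightarrow> card Y \<le> card X"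
    using ex_has_greatest_nat[of P _ card "Suc (card R)"] by blast
  have finX: "finite X"
    using X fin finite_subset unfolding P_def by blast
  have closed: "T s \<inter> R \<subseteq> R - X" if s: "s \<in> M" "w s \<in> R - X" for s
  proof (rule ccontr)
    assume "\<not> T s \<inter> R \<subseteq> R - X"
    then obtain k where k: "k \<in> X" "k \<in> T s \<inter> R" by blast
    then obtain w' where w': "inj_on w' M" "\<forall>s\<in>M. w' s \<in> T s \<inter> R" "k \<notin> w' ` M"
      "\<forall>s\<in>M. w s \<notin> X \<longrightarrow> w' s = w s"
      using X unfolding P_def by blast
    define w'' where "w'' = w'(s := k)"
    have "w' s = w s" using w'(4) s by blast
    then have "w s \<noteq> w'' t" if "t \<in> M" for t
      using inj_onD[OF w'(1), of s t] s k that unfolding w''_def by (cases "t = s") auto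
    then have "w s \<notin> w'' ` M" by blast
    moreover have "inj_on w'' M"
      using w'(1,3) unfolding w''_def by (rule inj_on_fun_updI)
    moreover have "\<forall>s\<in>M. w'' s \<in> T s \<inter> R"
      using w'(2) k unfolding w''_def by auto
    moreover have "\<forall>t\<in>M. w t \<notin> insert (w s) X \<longrightarrow> w'' t = w t"
      using w'(4) unfolding w''_def by auto
    ultimately have "P (insert (w s) X)"
      using X s unfolding P_def by (intro conjI) (blast, blast, metis insertE insertI2)
    from max[OF this] show False using finX s by simp
  qed
  show thesis
  proof (rule that[of "R - X"])
    show "R - X \<subseteq> w ` M" using X unfolding P_def by blast
    show "\<And>s. s \<in> M \<Longrightarrow> w s \<in> R - X \<Longrightarrow> T s \<inter> R \<subseteq> R - X" by (rule closed)
    show "\<exists>w'. inj_on w' M \<and> (\<forall>s\<in>M. w' s \<in> T s \<inter> R) \<and> k \<notin> w' ` M"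
      if "k \<in> R - (R - X)" for k
      using X that unfolding P_def by blast
  qed
qed

section \<open>Sign patterns and piercing\<close>

text \<open>
  A box with \<open>j\<close>-th projection \<open>[\<alpha>\<^sub>j, \<beta>\<^sub>j]\<close> is encoded as the function \<open>K\<close> with \<open>K (j, True) = \<beta>\<^sub>j\<close> and
  \<open>K (j, False) = - \<alpha>\<^sub>j\<close>, so that both kinds of extreme endpoints become minima. For
  \<open>v (j, True) = a\<^sub>j\<close> and \<open>v (j, False) = - b\<^sub>j\<close>, the set \<open>excl v K\<close> consists of the sides whose
  coordinate \<open>a\<^sub>j\<close> or \<open>b\<^sub>j\<close> lies outside the projection of the box.
\<close>

definition opp :: "'n \<times> bool \<Rightarrow> 'n \<times> bool" where
  "opp s = (fst s, \<not> snd s)"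

definition excl :: "('n \<times> bool \<Rightarrow> real) \<Rightarrow> ('n \<times> bool \<Rightarrow> real) \<Rightarrow> ('n \<times> bool) set" where
  "excl v K = {s. K (opp s) + v s < 0}"

text \<open>One candidate vertex uses the sides with \<open>snd s = \<epsilon> (fst s)\<close>, the
  opposite one the other sides. All of \<open>E\<close> must fall on one vertex; each pair
  \<open>s\<close>, \<open>t\<close> gives a linear equation over the field with two
  elements.\<close>

definition splits :: "('n \<Rightarrow> bool) \<Rightarrow> ('n \<times> bool) set \<Rightarrow> bool" where
  "splits \<epsilon> E \<longleftrightarrow> (\<forall>s\<in>E. \<forall>t\<in>E. (snd s = \<epsilon> (fst s)) = (snd t = \<epsilon> (fst t)))"

definition lies_in :: "('n \<Rightarrow> real) \<Rightarrow> ('n \<times> bool \<Rightarrow> real) \<Rightarrow> bool" where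
  "lies_in p K \<longleftrightarrow> (\<forall>j. - K (j, False) \<le> p j \<and> p j \<le> K (j, True))"

lemma splits_mono: "splits \<epsilon> E \<Longrightarrow> E' \<subseteq> E \<Longrightarrow> splits \<epsilon> E'"
  unfolding splits_def by blast

lemma splits_Not: "splits \<epsilon> E \<Longrightarrow> splits (\<lambda>j. \<not> \<epsilon> j) E"
  unfolding splits_def by blast

lemma splits_affine:
  assumes "splits a E" "splits b E" "splits c E"
  shows "splits (\<lambda>j. a j = (b j = c j)) E"
  unfolding splits_def
proof (intro ballI)
  fix s t assume "s \<in> E" "t \<in> E"
  then have "(snd s = a (fst s)) = (snd t = a (fst t))" "(snd s = b (fst s)) = (snd t = b (fst t))"
    "(snd s = c (fst s)) = (snd t = c (fst t))"
    using assms unfolding splits_def by blast+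
  then show "(snd s = (a (fst s) = (b (fst s) = c (fst s)))) = (snd t = (a (fst t) = (b (fst t) = c (fst t))))"
    by argo
qed

text \<open>The minima are attained, so in each coordinate the smaller of \<open>p j\<close>,
  \<open>q j\<close> is at most the least right endpoint and the larger is at least the greatest
  left endpoint. Assigning these sides accordingly, a box containing a point excludes no side
  assigned to it.\<close>

lemma splits_if_pierced:
  assumes fin: "finite I" and ne: "I \<noteq> {}"
    and pierced: "\<And>k. k \<in> I \<Longrightarrow> lies_in p (C k) \<or> lies_in q (C k)"
  shows "\<exists>\<epsilon>. \<forall>k\<in>I. splits \<epsilon> (excl (\<lambda>s. Min ((\<lambda>k. C k s) ` I)) (C k))"
proof -
  define u where "u s = Min ((\<lambda>k. C k s) ` I)" for s
  have att: "\<exists>k\<in>I. C k s = u s" for s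
  proof -
    have "u s \<in> (\<lambda>k. C k s) ` I"
      using fin ne unfolding u_def by (intro Min_in) auto
    then show ?thesis by auto
  qed
  have r: "min (p j) (q j) \<le> u (j, True)" for j
    using att[of "(j, True)"] pierced unfolding lies_in_def
    by (metis min.coboundedI1 min.coboundedI2)
  have l: "- u (j, False) \<le> max (p j) (q j)" for j
    using att[of "(j, False)"] pierced unfolding lies_in_def
    by (metis max.coboundedI1 max.coboundedI2)
  define \<epsilon> where "\<epsilon> j \<longleftrightarrow> p j \<le> q j" for j
  have "splits \<epsilon> (excl u (C k))" if "k \<in> I" for k
    using pierced[OF that]
  proof
    assume w: "lies_in p (C k)"
    have "snd s \<noteq> \<epsilon> (fst s)" if "s \<in> excl u (C k)" for s
      using that w r[of "fst s"] l[of "fst s"]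
      unfolding excl_def lies_in_def \<epsilon>_def opp_def
      by (cases s; cases "snd s") (auto simp: min_def max_def split: if_splits dest!: spec[of _ "fst s"])
    then show ?thesis unfolding splits_def by blast
  next
    assume w: "lies_in q (C k)"
    have "snd s = \<epsilon> (fst s)" if "s \<in> excl u (C k)" for s
      using that w r[of "fst s"] l[of "fst s"]
      unfolding excl_def lies_in_def \<epsilon>_def opp_def
      by (cases s; cases "snd s") (auto simp: min_def max_def split: if_splits dest!: spec[of _ "fst s"])
    then show ?thesis unfolding splits_def by blast
  qed
  then show ?thesis unfolding u_def by blast
qed

text \<open>The vertex whose sides avoid \<open>excl v K\<close> lies in the box: in each coordinate
  one bound is the absence of exclusion, the other is \<open>v s \<le> K s\<close>.\<close>

lemma pierced_if_splits:
  assumes "splits \<epsilon> (excl v K)" and "\<And>s. v s \<le> K s"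
  shows "lies_in (\<lambda>j. if \<epsilon> j then v (j, True) else - v (j, False)) K \<or>
         lies_in (\<lambda>j. if \<epsilon> j then - v (j, False) else v (j, True)) K"
proof -
  have "(\<forall>s\<in>excl v K. snd s \<noteq> \<epsilon> (fst s)) \<or> (\<forall>s\<in>excl v K. snd s = \<epsilon> (fst s))"
    using assms(1) unfolding splits_def by blast
  then show ?thesis
  proof
    assume h: "\<forall>s\<in>excl v K. snd s \<noteq> \<epsilon> (fst s)"
    have "(j, \<epsilon> j) \<notin> excl v K" for j using h by force
    then have "0 \<le> K (j, \<not> \<epsilon> j) + v (j, \<epsilon> j)" "v (j, True) \<le> K (j, True)" "v (j, False) \<le> K (j, False)" for j
      using assms(2) by (simp_all add: excl_def opp_def not_less)
    then show ?thesis
      unfolding lies_in_def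
      by (intro disjI1 allI) (smt (verit))
  next
    assume h: "\<forall>s\<in>excl v K. snd s = \<epsilon> (fst s)"
    have "(j, \<not> \<epsilon> j) \<notin> excl v K" for j using h by force
    then have "0 \<le> K (j, \<epsilon> j) + v (j, \<not> \<epsilon> j)" "v (j, True) \<le> K (j, True)" "v (j, False) \<le> K (j, False)" for j
      using assms(2) by (simp_all add: excl_def opp_def not_less)
    then show ?thesis
      unfolding lies_in_def
      by (intro disjI2 allI) (smt (verit))
  qed
qed

text \<open>Exclusion is a strict inequality, so for finitely many boxes it survives a small
  increase of \<open>v\<close>, and an increase never creates an exclusion.\<close>

lemma excl_stable:
  fixes v :: "'n::finite \<times> bool \<Rightarrow> real"
  assumes "finite X"
  obtains \<delta> where "\<delta> > 0"
    "\<And>u K. \<lbrakk>K \<in> X; \<And>s. s \<in> Q \<Longrightarrow> v s \<le> u s \<and> u s < v s + \<delta>\<rbrakk> \<Longrightarrow> excl u K \<inter> Q = excl v K \<inter> Q"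
proof -
  have "\<forall>\<^sub>F \<delta> in at_right 0. K (opp s) + v s < 0 \<longrightarrow> K (opp s) + v s + \<delta> \<le> 0" for K s
  proof (cases "K (opp s) + v s < 0")
    case True
    have "\<forall>\<^sub>F \<delta> in at_right 0. \<delta> < - (K (opp s) + v s)"
      using True by (intro eventually_at_rightI[of 0 "- (K (opp s) + v s)"]) auto
    then show ?thesis by eventually_elim auto
  qed auto
  then have "\<forall>\<^sub>F \<delta> in at_right 0. \<forall>K\<in>X. \<forall>s\<in>UNIV. K (opp s) + v s < 0 \<longrightarrow> K (opp s) + v s + \<delta> \<le> 0"
    using assms by (intro eventually_ball_finite ballI) auto
  then obtain b where b: "b > 0" "\<And>\<delta>. \<lbrakk>\<delta> > 0; \<delta> < b\<rbrakk> \<Longrightarrow>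
      \<forall>K\<in>X. \<forall>s\<in>UNIV. K (opp s) + v s < 0 \<longrightarrow> K (opp s) + v s + \<delta> \<le> 0"
    unfolding eventually_at_right_field by auto
  have h: "K (opp s) + v s + b/2 \<le> 0" if "K \<in> X" "K (opp s) + v s < 0" for K s
    using b(2)[of "b/2"] b(1) that by (smt (verit) UNIV_I field_sum_of_halves)
  show thesis
  proof (rule that[of "b/2"])
    show "b/2 > 0" using b by simp
    fix u K assume K: "K \<in> X" and u: "\<And>s. s \<in> Q \<Longrightarrow> v s \<le> u s \<and> u s < v s + b/2"
    show "excl u K \<inter> Q = excl v K \<inter> Q"
      
    proof (intro set_eqI iffI)
      fix s assume "s \<in> excl u K \<inter> Q"
      then show "s \<in> excl v K \<inter> Q" using u[of s] unfolding excl_def by auto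
    next
      fix s assume "s \<in> excl v K \<inter> Q"
      then show "s \<in> excl u K \<inter> Q" using u[of s] h[OF K, of s] unfolding excl_def by auto
    qed
  qed
qed

section \<open>Counting patterns and approaching endpoints\<close>

text \<open>If imposing one more constraint on the sign patterns removes some but not all of them, at
  least half of them disappear, because translation by the difference of a removed and a
  remaining pattern maps the remaining ones into the removed ones.\<close>
lemma card_affine_halving:
  fixes X Y :: "('n::finite \<Rightarrow> bool) set"
  assumes X: "\<And>a b c. \<lbrakk>a \<in> X; b \<in> X; c \<in> X\<rbrakk> \<Longrightarrow> (\<lambda>j. a j = (b j = c j)) \<in> X"
    and Y: "\<And>a b c. \<lbrakk>a \<in> Y; b \<in> Y; c \<in> Y\<rbrakk> \<Longrightarrow> (\<lambda>j. a j = (b j = c j)) \<in> Y"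
    and sub: "X \<subset> Y" and ne: "X \<noteq> {}"
  shows "2 * card X \<le> card Y"
proof -
  obtain a b where a: "a \<in> X" and b: "b \<in> Y" "b \<notin> X" using sub ne by blast
  define f where "f x = (\<lambda>j. x j = (a j = b j))" for x :: "'n \<Rightarrow> bool"
  have inj: "inj_on f X"
    
  proof (intro inj_onI ext)
    fix x y j assume "f x = f y"
    then have "f x j = f y j" by simp
    then show "x j = y j" unfolding f_def by argo
  qed
  have "f x \<in> Y - X" if x: "x \<in> X" for x
  proof -
    have "f x \<in> Y" unfolding f_def using Y x a b sub by blast
    moreover have "f x \<notin> X"
    proof
      assume "f x \<in> X"
      then have "(\<lambda>j. x j = (a j = f x j)) \<in> X" using X x a by blast
      moreover have "(\<lambda>j. x j = (a j = f x j)) = b" unfolding f_def by auto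
      ultimately show False using b by simp
    qed
    ultimately show ?thesis by blast
  qed
  then have "card (f ` X) \<le> card (Y - X)" by (intro card_mono) auto
  moreover have "card (Y - X) = card Y - card X" using sub by (intro card_Diff_subset) auto
  moreover have "card X \<le> card Y" using sub by (intro card_mono) auto
  ultimately show ?thesis using card_image[OF inj] by linarith
qed

definition near :: "('n \<times> bool \<Rightarrow> real) set \<Rightarrow> real \<Rightarrow> 'n \<times> bool \<Rightarrow> bool" where
  "near X z s \<longleftrightarrow> (\<forall>\<delta>>0. \<exists>K\<in>X. K s < z + \<delta>)"

lemma not_near_eventually:
  assumes "\<not> near X z s"
  shows "\<forall>\<^sub>F \<delta> in at_right 0. \<forall>K\<in>X. z + \<delta> \<le> K s"
proof -
  obtain d where d: "d > 0" "\<And>K. K \<in> X \<Longrightarrow> z + d \<le> K s"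
    using assms unfolding near_def by (meson not_le)
  have "\<forall>\<^sub>F \<delta> in at_right 0. \<delta> < d"
    using d by (intro eventually_at_rightI[of 0 d]) auto
  then show ?thesis
    by eventually_elim (use d(2) in force)
qed

text \<open>Exclusions are tested on \<open>Q\<close> alone because \<open>v\<close> carries
  information only on treated sides.\<close>

definition sol :: "('n \<times> bool) set \<Rightarrow> 'k set \<Rightarrow> ('k \<Rightarrow> 'n \<times> bool \<Rightarrow> real) \<Rightarrow>
    ('n \<times> bool \<Rightarrow> real) \<Rightarrow> ('n \<Rightarrow> bool) set" where
  "sol Q A g v = {\<epsilon>. \<forall>k\<in>A. splits \<epsilon> (excl v (g k) \<inter> Q)}"

lemma sol_affine:
  "\<lbrakk>a \<in> sol Q A g v; b \<in> sol Q A g v; c \<in> sol Q A g v\<rbrakk> \<Longrightarrow> (\<lambda>j. a j = (b j = c j)) \<in> sol Q A g v"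
  unfolding sol_def using splits_affine by blast

text \<open>Interchanging the two piercing points negates a pattern, so patterns come in pairs. This
  makes the bound in \<open>card_less_N\<close> strict.\<close>

lemma card_sol_ge_2:
  fixes v :: "'n::finite \<times> bool \<Rightarrow> real"
  assumes "sol Q A g v \<noteq> {}"
  shows "2 \<le> card (sol Q A g v)"
proof -
  obtain a where a: "a \<in> sol Q A g v" using assms by blast
  then have "(\<lambda>j. \<not> a j) \<in> sol Q A g v"
    unfolding sol_def using splits_Not by blast
  then have "card {a, \<lambda>j. \<not> a j} \<le> card (sol Q A g v)"
    using a by (intro card_mono) auto
  moreover have "a \<noteq> (\<lambda>j. \<not> a j)" by (metis (full_types))
  ultimately show ?thesis by simp
qed

section \<open>Greedy selection of colours\<close>

locale colourful_sides =
  fixes F :: "nat \<Rightarrow> ('n::finite \<times> bool \<Rightarrow> real) set" and N :: nat and lb :: real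
  assumes N: "N = 3 * CARD('n)"
    and nonempty: "k < N \<Longrightarrow> F k \<noteq> {}"
    and bounded: "\<lbrakk>k < N; K \<in> F k\<rbrakk> \<Longrightarrow> lb \<le> K s"
    and colourful: "(\<And>k. k < N \<Longrightarrow> C k \<in> F k) \<Longrightarrow>
      \<exists>\<epsilon>. \<forall>k<N. splits \<epsilon> (excl (\<lambda>s. Min ((\<lambda>k. C k s) ` {..<N})) (C k))"
begin

text \<open>
  The state of the greedy selection: \<open>A\<close> is the set of colours already picked and \<open>g\<close> the picked
  boxes, \<open>Q\<close> the set of sides treated so far with extreme values \<open>v\<close>, and \<open>M\<close> the sides that are only
  reserved. The last conjunct says that every reservation and every pick is paid for by treating a
  side or by halving the set of patterns.
\<close>

definition frame where
  "frame Q A g M v \<longleftrightarrow> A \<subseteq> {..<N} \<and> M \<subseteq> Q \<and> (\<forall>k\<in>A. g k \<in> F k) \<and>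
     (\<forall>s\<in>Q. \<forall>k\<in>A. v s \<le> g k s) \<and> (\<forall>s\<in>Q. \<forall>k\<in>{..<N} - A. \<forall>K\<in>F k. v s \<le> K s) \<and>
     (\<forall>s\<in>Q - M. \<exists>k\<in>A. g k s = v s) \<and>
     card (sol Q A g v) * 2 ^ (card M + card A) \<le> 2 ^ (CARD('n) + card Q)"

text \<open>Distinct colours for distinct sides let a single colourful tuple approach all reserved
  endpoints at once.\<close>

definition matched where
  "matched A M v w \<longleftrightarrow> inj_on w M \<and> (\<forall>s\<in>M. w s \<in> {..<N} - A \<and> near (F (w s)) (v s) s)"

text \<open>Complete \<open>h\<close> to a colourful tuple, taking from each matched colour a box
  close to the endpoint reserved for it. On \<open>Q\<close> the minima of the tuple exceed
  \<open>v\<close> by less than \<delta>, so by \<open>excl_stable\<close> its pattern also serves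
  \<open>v\<close>.\<close>

lemma common_split:
  assumes fr: "frame Q A g M v" and m: "matched A M v w"
    and B: "A \<subseteq> B" "B \<subseteq> {..<N}" "\<And>k. k \<in> B \<Longrightarrow> h k \<in> F k" "\<And>k. k \<in> A \<Longrightarrow> h k = g k"
    and disj: "w ` M \<inter> B = {}"
  shows "\<exists>\<epsilon>. \<forall>k\<in>B. splits \<epsilon> (excl v (h k) \<inter> Q)"
proof -
  have "finite (h ` B)" using B(2) finite_subset by blast
  then obtain \<delta> where \<delta>: "\<delta> > 0" and stable: "\<And>u K. \<lbrakk>K \<in> h ` B;
      \<And>s. s \<in> Q \<Longrightarrow> v s \<le> u s \<and> u s < v s + \<delta>\<rbrakk> \<Longrightarrow> excl u K \<inter> Q = excl v K \<inter> Q"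
    using excl_stable[of "h ` B" Q v] by metis
  have "\<forall>s\<in>M. \<exists>K. K \<in> F (w s) \<and> K s < v s + \<delta>"
    using m \<delta> unfolding matched_def near_def by blast
  then obtain c where c: "\<And>s. s \<in> M \<Longrightarrow> c s \<in> F (w s) \<and> c s s < v s + \<delta>"
    by metis
  \<comment> \<open>Colours neither in \<open>B\<close> nor matched only fill up the tuple; by
    \<open>frame\<close> none of their boxes undercuts \<open>v\<close> on \<open>Q\<close>.\<close>
  define C where "C k = (if k \<in> B then h k else if k \<in> w ` M then c (inv_into M w k)
      else (SOME K. K \<in> F k))" for k
  have Cw: "C (w s) = c s" if "s \<in> M" for s
    using that disj m unfolding C_def matched_def by auto
  have CF: "C k \<in> F k" if "k < N" for k
  proof (cases "k \<in> w ` M \<and> k \<notin> B")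
    case True
    then obtain s where "s \<in> M" "k = w s" by blast
    then show ?thesis using Cw c by simp
  next
    case False
    then show ?thesis using B(3) nonempty[OF that] unfolding C_def by (auto simp: some_in_eq)
  qed
  define u where "u s = Min ((\<lambda>k. C k s) ` {..<N})" for s
  obtain \<epsilon> where \<epsilon>: "\<forall>k<N. splits \<epsilon> (excl u (C k))"
    using colourful[of C] CF unfolding u_def by blast
  have "v s \<le> u s \<and> u s < v s + \<delta>" if s: "s \<in> Q" for s
  proof
    have "v s \<le> C k s" if "k < N" for k
    proof (cases "k \<in> A")
      case True
      then show ?thesis using fr s B unfolding frame_def C_def by auto
    next
      case False
      then show ?thesis using fr s CF[OF that] that unfolding frame_def by blast
    qed
    then show "v s \<le> u s"
      unfolding u_def using N by (subst Min_ge_iff) (auto simp: lessThan_empty_iff)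
    have le: "u s \<le> C k s" if "k < N" for k
      unfolding u_def using that by (intro Min_le) auto
    show "u s < v s + \<delta>"
    proof (cases "s \<in> M")
      case True
      then have "w s < N" using m unfolding matched_def by blast
      from le[OF this] show ?thesis using Cw[OF True] c[OF True] by simp
    next
      case False
      then obtain k where k: "k \<in> A" "g k s = v s" using fr s unfolding frame_def by blast
      then have "k < N" "C k s = v s" using B unfolding C_def by auto
      with le[of k] \<delta> show ?thesis by simp
    qed
  qed
  then have "excl u (h k) \<inter> Q = excl v (h k) \<inter> Q" if "k \<in> B" for k
    using stable that by blast
  moreover have "splits \<epsilon> (excl u (h k) \<inter> Q)" if "k \<in> B" for k
    using \<epsilon> that B(2) splits_mono[of \<epsilon> "excl u (h k)"] unfolding C_def by fastforce
  ultimately show ?thesis by auto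
qed

text \<open>At least two patterns survive, and \<open>CARD('n) + card Q\<close> is at most
  \<open>3 * CARD('n)\<close>. Here the number of colours enters: picks and reservations together
  never use them all up.\<close>

lemma card_less_N:
  assumes fr: "frame Q A g M v" and m: "matched A M v w"
  shows "card M + card A < N"
proof -
  have "sol Q A g v \<noteq> {}"
    using common_split[OF fr m, of A g] fr m unfolding frame_def matched_def sol_def by blast
  then have "2 * 2 ^ (card M + card A) \<le> card (sol Q A g v) * 2 ^ (card M + card A)"
    by (intro mult_right_mono card_sol_ge_2) auto
  also have "\<dots> \<le> 2 ^ (CARD('n) + card Q)" using fr unfolding frame_def by blast
  also have "card Q \<le> CARD('n \<times> bool)" by (intro card_mono) auto
  then have "(2::nat) ^ (CARD('n) + card Q) \<le> 2 ^ N"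
    using N by (intro power_increasing) auto
  finally have "(2::nat) ^ Suc (card M + card A) \<le> 2 ^ N" by simp
  then have "Suc (card M + card A) \<le> N" by (rule power_le_imp_le_exp[rotated]) simp
  then show ?thesis by simp
qed

text \<open>Boxes close enough to the endpoints matched into \<open>U\<close>, one from each colour
  of \<open>U\<close>, undercut all colours left over on these sides. The minima over the picks then
  become attained extreme values.\<close>

lemma select_tight:
  assumes fr: "frame Q A g M v" and m: "matched A M v w" and U: "U \<subseteq> w ` M" "U \<noteq> {}"
    and tight: "\<And>s k. \<lbrakk>s \<in> M; w s \<in> U; k \<in> {..<N} - A; near (F k) (v s) s\<rbrakk> \<Longrightarrow> k \<in> U"
  shows "\<exists>A' g' M' v'. frame Q A' g' M' v' \<and> matched A' M' v' w \<and> card A < card A'"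
proof -
  define MU where "MU = {s \<in> M. w s \<in> U}"
  define A' where "A' = A \<union> U"
  have wM: "w ` M \<subseteq> {..<N} - A" and inj: "inj_on w M" using m unfolding matched_def by auto
  have AN: "A \<subseteq> {..<N}" "finite A" using fr finite_subset unfolding frame_def by auto
  have "A' \<subseteq> {..<N}" "A' \<noteq> {}" using U wM AN unfolding A'_def by auto
  then have A'N: "A' \<subseteq> {..<N}" "finite A'" "A' \<noteq> {}" using finite_subset by auto
  have "finite (g ` A)" using AN by auto
  then obtain \<delta>\<^sub>0 where \<delta>\<^sub>0: "\<delta>\<^sub>0 > 0" and stable: "\<And>u K. \<lbrakk>K \<in> g ` A;
      \<And>s. s \<in> Q \<Longrightarrow> v s \<le> u s \<and> u s < v s + \<delta>\<^sub>0\<rbrakk> \<Longrightarrow> excl u K \<inter> Q = excl v K \<inter> Q"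
    using excl_stable[of "g ` A" Q v] by metis
  have "\<forall>\<^sub>F \<delta> in at_right 0. \<delta> > (0::real) \<and> \<delta> < \<delta>\<^sub>0 \<and>
      (\<forall>s\<in>MU. \<forall>k\<in>{..<N} - A'. \<forall>K\<in>F k. v s + \<delta> \<le> K s)"
    using \<delta>\<^sub>0 tight unfolding MU_def A'_def
    by (intro eventually_conj eventually_ball_finite ballI not_near_eventually)
       (auto intro: eventually_at_rightI[of 0 \<delta>\<^sub>0] simp: eventually_at_right_less)
  \<comment> \<open>Being below \<open>\<delta>\<^sub>0\<close>, the margin preserves the exclusions
    of the old picks; it also separates the new values from the colours left over.\<close>
  then obtain \<delta> where \<delta>: "\<delta> > 0" "\<delta> < \<delta>\<^sub>0"
    and far: "\<And>s k K. \<lbrakk>s \<in> MU; k \<in> {..<N} - A'; K \<in> F k\<rbrakk> \<Longrightarrow> v s + \<delta> \<le> K s"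
    using eventually_happens'[OF trivial_limit_at_right_real] by blast
  have "\<forall>s\<in>M. \<exists>K. K \<in> F (w s) \<and> K s < v s + \<delta>"
    using m \<delta> unfolding matched_def near_def by blast
  then obtain c where c: "\<And>s. s \<in> M \<Longrightarrow> c s \<in> F (w s) \<and> c s s < v s + \<delta>"
    by metis
  define g' where "g' k = (if k \<in> U then c (inv_into M w k) else g k)" for k
  have g'w: "g' (w s) = c s" if "s \<in> MU" for s
    using that inj unfolding g'_def MU_def by auto
  have g'A: "g' k = g k" if "k \<in> A" for k
    using that U wM unfolding g'_def by auto
  have g'F: "g' k \<in> F k" if "k \<in> A'" for k
  proof (cases "k \<in> U")
    case True
    then obtain s where "s \<in> MU" "k = w s" using U unfolding MU_def by blast
    then show ?thesis using g'w c unfolding MU_def by auto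
  next
    case False
    then show ?thesis using that g'A fr unfolding A'_def frame_def by auto
  qed
  have low: "v s \<le> g' k s" if "s \<in> Q" "k \<in> A'" for s k
  proof (cases "k \<in> A")
    case True
    then show ?thesis using g'A fr that unfolding frame_def by auto
  next
    case False
    then show ?thesis using g'F[OF that(2)] fr that A'N unfolding frame_def by blast
  qed
  define v' where "v' s = (if s \<in> MU then Min ((\<lambda>k. g' k s) ` A') else v s)" for s
  have MUQ: "MU \<subseteq> M" "M \<subseteq> Q" using fr unfolding MU_def frame_def by auto
  have close: "v s \<le> v' s \<and> v' s < v s + \<delta>" if s: "s \<in> Q" for s
  proof (cases "s \<in> MU")
    case True
    have "v s \<le> v' s"
      using True low[OF s] A'N unfolding v'_def by (auto simp: Min_ge_iff)
    moreover have "v' s \<le> g' (w s) s"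
      using True A'N unfolding v'_def by (auto intro!: Min_le simp: MU_def A'_def)
    ultimately show ?thesis using g'w[OF True] c[of s] True MUQ by auto
  qed (use \<delta> in \<open>auto simp: v'_def\<close>)
  have "sol Q A' g' v' \<subseteq> sol Q A g v"
  proof -
    have "excl v' (g k) \<inter> Q = excl v (g k) \<inter> Q" if "k \<in> A" for k
    proof (rule stable)
      show "v s \<le> v' s \<and> v' s < v s + \<delta>\<^sub>0" if "s \<in> Q" for s
        using close[OF that] \<delta> by linarith
    qed (use that in auto)
    then have same: "excl v' (g' k) \<inter> Q = excl v (g k) \<inter> Q" if "k \<in> A" for k
      using that g'A by simp
    show ?thesis
    proof
      fix \<epsilon> assume "\<epsilon> \<in> sol Q A' g' v'"
      then have "splits \<epsilon> (excl v' (g' k) \<inter> Q)" if "k \<in> A" for k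
        using that unfolding sol_def A'_def by blast
      then have "splits \<epsilon> (excl v (g k) \<inter> Q)" if "k \<in> A" for k
        using that by (simp only: same)
      then show "\<epsilon> \<in> sol Q A g v" unfolding sol_def by simp
    qed
  qed
  then have "card (sol Q A' g' v') \<le> card (sol Q A g v)" by (intro card_mono) auto
  moreover have cardU: "card MU = card U"
  proof -
    have "w ` MU = U" using U unfolding MU_def by blast
    moreover have "inj_on w MU" using inj MUQ inj_on_subset by blast
    ultimately show ?thesis using card_image by metis
  qed
  moreover have finU: "finite U" using A'N unfolding A'_def by auto
  moreover have cardA': "card A' = card A + card U"
    unfolding A'_def using AN finU U wM by (intro card_Un_disjoint) auto
  moreover have "card (M - MU) + card MU = card M"
    using MUQ by (simp add: card_Diff_subset card_mono)
  \<comment> \<open>Each side in \<open>MU\<close> trades its reservation for one pick, so the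
    exponent is unchanged and no halving is required.\<close>
  ultimately have "card (sol Q A' g' v') * 2 ^ (card (M - MU) + card A') \<le>
      card (sol Q A g v) * 2 ^ (card M + card A)"
    by (intro mult_mono) auto
  also have "\<dots> \<le> 2 ^ (CARD('n) + card Q)" using fr unfolding frame_def by blast
  finally have count: "card (sol Q A' g' v') * 2 ^ (card (M - MU) + card A') \<le> 2 ^ (CARD('n) + card Q)" .
  have "frame Q A' g' (M - MU) v'"
    unfolding frame_def
  proof (intro conjI ballI count A'N)
    show "M - MU \<subseteq> Q" using MUQ by blast
    show "g' k \<in> F k" if "k \<in> A'" for k by (rule g'F[OF that])
    show "v' s \<le> g' k s" if "s \<in> Q" "k \<in> A'" for s k
      using low[OF that] that A'N unfolding v'_def by auto
    show "v' s \<le> K s" if "s \<in> Q" "k \<in> {..<N} - A'" "K \<in> F k" for s k K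
    proof (cases "s \<in> MU")
      case True
      then show ?thesis using far[OF True that(2,3)] close[OF that(1)] by linarith
    next
      case False
      then show ?thesis using fr that unfolding frame_def v'_def A'_def by auto
    qed
    show "\<exists>k\<in>A'. g' k s = v' s" if s: "s \<in> Q - (M - MU)" for s
    proof (cases "s \<in> MU")
      case True
      have "Min ((\<lambda>k. g' k s) ` A') \<in> (\<lambda>k. g' k s) ` A'" using A'N by (intro Min_in) auto
      then show ?thesis using True unfolding v'_def by auto
    next
      case False
      then obtain k where "k \<in> A" "g k s = v s" using fr s unfolding frame_def by blast
      then have "k \<in> A'" "g' k s = v' s" using False g'A unfolding v'_def A'_def by auto
      then show ?thesis by blast
    qed
  qed
  moreover have "matched A' (M - MU) v' w"
    using m unfolding matched_def v'_def A'_def MU_def by (auto intro: inj_on_subset)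
  moreover have "card A < card A'"
    using cardA' finU U by (simp add: card_gt_0_iff)
  ultimately show ?thesis by blast
qed

text \<open>If no picked box attains the infimum \<open>z\<close>, some remaining colour comes
  arbitrarily close, since there are finitely many colours; \<open>free\<close> makes it available
  for a reservation. The new side pays for this.\<close>

lemma extend_side:
  assumes fr: "frame Q A g M v" and s: "s \<notin> Q" and m: "matched A M v w"
    and free: "\<And>k. k \<in> {..<N} - A \<Longrightarrow> \<exists>w. matched A M v w \<and> k \<notin> w ` M"
  shows "\<exists>M' v' w'. frame (insert s Q) A g M' v' \<and> matched A M' v' w'"
proof -
  \<comment> \<open>Of a picked colour only the picked box counts from now on.\<close>
  define Z where "Z = (\<lambda>k. g k s) ` A \<union> (\<Union>k\<in>{..<N} - A. (\<lambda>K. K s) ` F k)"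
  define z where "z = Inf Z"
  have AN: "A \<subseteq> {..<N}" "finite A" "\<And>k. k \<in> A \<Longrightarrow> g k \<in> F k"
    using fr finite_subset unfolding frame_def by auto
  have bdd: "bdd_below Z"
    unfolding Z_def bdd_below_def using AN bounded by blast
  have Zne: "Z \<noteq> {}"
    using N nonempty[of 0] unfolding Z_def by (cases "0 \<in> A") auto
  define v' where "v' = v(s := z)"
  have lowA: "z \<le> g k s" if "k \<in> A" for k
    unfolding z_def using that by (intro cInf_lower bdd) (auto simp: Z_def)
  have lowF: "z \<le> K s" if "k \<in> {..<N} - A" "K \<in> F k" for k K
    unfolding z_def using that by (intro cInf_lower bdd) (auto simp: Z_def)
  have "excl v (g k) \<inter> Q \<subseteq> excl v' (g k) \<inter> insert s Q" for k
    using s unfolding excl_def v'_def by auto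
  then have "sol (insert s Q) A g v' \<subseteq> sol Q A g v"
    unfolding sol_def using splits_mono by blast
  then have card_sol: "card (sol (insert s Q) A g v') \<le> card (sol Q A g v)"
    by (intro card_mono) auto
  have frI: "frame (insert s Q) A g M' v'"
    if M': "M' = insert s M \<or> M' = M \<and> (\<exists>k\<in>A. g k s = z)" for M'
  proof -
    have "card M' \<le> Suc (card M)" using M' by (auto simp: card_insert_if)
    then have "card (sol (insert s Q) A g v') * 2 ^ (card M' + card A) \<le>
        card (sol Q A g v) * 2 ^ (Suc (card M) + card A)"
      using card_sol by (intro mult_mono power_increasing) auto
    also have "\<dots> \<le> 2 * 2 ^ (CARD('n) + card Q)" using fr unfolding frame_def by simp
    also have "\<dots> = 2 ^ (CARD('n) + card (insert s Q))" using s by simp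
    finally show ?thesis
      using fr M' s lowA lowF unfolding frame_def v'_def by auto
  qed
  show ?thesis
  proof (cases "\<exists>k\<in>A. g k s = z")
    case True
    have "matched A M v' w"
      using m s fr unfolding matched_def v'_def frame_def by auto
    then show ?thesis using frI[of M] True by blast
  next
    case False
    have "\<exists>k\<in>{..<N} - A. near (F k) z s"
    proof (rule ccontr)
      assume no: "\<not> ?thesis"
      have "\<not> near {g k} z s" if "k \<in> A" for k
        using that False lowA[OF that] unfolding near_def
        by (auto intro!: exI[of _ "g k s - z"] simp: less_le)
      then have "\<forall>\<^sub>F \<delta> in at_right 0. \<delta> > 0 \<and> (\<forall>k\<in>A. \<forall>K\<in>{g k}. z + \<delta> \<le> K s) \<and>
          (\<forall>k\<in>{..<N} - A. \<forall>K\<in>F k. z + \<delta> \<le> K s)"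
        using no AN
        by (intro eventually_conj eventually_ball_finite ballI not_near_eventually)
           (auto simp: eventually_at_right_less)
      then obtain \<delta> where "\<delta> > 0" and \<delta>: "\<forall>k\<in>A. \<forall>K\<in>{g k}. z + \<delta> \<le> K s"
          "\<forall>k\<in>{..<N} - A. \<forall>K\<in>F k. z + \<delta> \<le> K s"
        using eventually_happens'[OF trivial_limit_at_right_real] by blast
      have "z + \<delta> \<le> x" if "x \<in> Z" for x
        using that \<delta> unfolding Z_def by blast
      then have "z + \<delta> \<le> Inf Z" by (intro cInf_greatest Zne)
      then have "z + \<delta> \<le> z" unfolding z_def .
      with \<open>\<delta> > 0\<close> show False by simp
    qed
    then obtain k where k: "k \<in> {..<N} - A" "near (F k) z s" by blast
    then obtain w' where w': "matched A M v w'" "k \<notin> w' ` M" using free by blast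
    have sM: "s \<notin> M" using s fr unfolding frame_def by blast
    have "inj_on (w'(s := k)) (insert s M)"
      using w' sM unfolding matched_def by (auto intro!: inj_on_fun_updI)
    then have "matched A (insert s M) v' (w'(s := k))"
      using w' k sM unfolding matched_def v'_def by auto
    then show ?thesis using frI[of "insert s M"] by blast
  qed
qed

text \<open>As \<open>k\<close> is unmatched, \<open>common_split\<close> leaves some pattern after
  the pick. A proper restriction therefore halves the patterns, which pays for the pick.\<close>

lemma select_merging:
  assumes fr: "frame Q A g M v" and m: "matched A M v w"
    and k: "k \<in> {..<N} - A" "k \<notin> w ` M" "K \<in> F k"
    and ne: "sol Q (insert k A) (g(k := K)) v \<noteq> sol Q A g v"
  shows "frame Q (insert k A) (g(k := K)) M v \<and> matched (insert k A) M v w"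
proof
  have same: "(g(k := K)) l = g l" if "l \<in> A" for l using that k by auto
  have "\<exists>\<epsilon>. \<forall>l\<in>insert k A. splits \<epsilon> (excl v ((g(k := K)) l) \<inter> Q)"
    by (rule common_split[OF fr m]) (use fr m k in \<open>auto simp: frame_def matched_def\<close>)
  then have "sol Q (insert k A) (g(k := K)) v \<noteq> {}" unfolding sol_def by blast
  moreover have "sol Q (insert k A) (g(k := K)) v \<subset> sol Q A g v"
    using ne same unfolding sol_def by auto
  ultimately have half: "2 * card (sol Q (insert k A) (g(k := K)) v) \<le> card (sol Q A g v)"
    by (intro card_affine_halving sol_affine)
  have "finite A" using fr finite_subset unfolding frame_def by blast
  then have "card (sol Q (insert k A) (g(k := K)) v) * 2 ^ (card M + card (insert k A)) =
      2 * card (sol Q (insert k A) (g(k := K)) v) * 2 ^ (card M + card A)"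
    using k by simp
  also have "\<dots> \<le> card (sol Q A g v) * 2 ^ (card M + card A)"
    using half by (intro mult_right_mono) auto
  also have "\<dots> \<le> 2 ^ (CARD('n) + card Q)" using fr unfolding frame_def by blast
  finally show "frame Q (insert k A) (g(k := K)) M v"
    using fr k same unfolding frame_def by auto
  show "matched (insert k A) M v w"
    using m k unfolding matched_def by auto
qed

text \<open>In a state maximising \<open>card A + card Q\<close> none of the three moves
  \<open>select_tight\<close>, \<open>extend_side\<close> and \<open>select_merging\<close>
  applies.\<close>

theorem common_pattern:
  "\<exists>i<N. \<exists>G v \<epsilon>. (\<forall>k<N. k \<noteq> i \<longrightarrow> G k \<in> F k) \<and>
     (\<forall>K \<in> F i \<union> G ` ({..<N} - {i}). (\<forall>s. v s \<le> K s) \<and> splits \<epsilon> (excl v K))"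
proof -
  define P where "P n \<longleftrightarrow> (\<exists>Q A g M v w. frame Q A g M v \<and> matched A M v w \<and> card A + card Q = n)" for n
  \<comment> \<open>Without constraints all \<open>2 ^ CARD('n)\<close> patterns are compatible,
    exactly the initial budget.\<close>
  have "frame {} {} (\<lambda>_ _. 0) {} (\<lambda>_. 0)" "matched {} {} (\<lambda>_. 0) (\<lambda>_. 0)"
    unfolding frame_def matched_def sol_def by (auto simp: card_fun)
  then have "P 0" unfolding P_def by force
  moreover have bound: "n \<le> N + CARD('n \<times> bool)" if Pn: "P n" for n
  proof -
    obtain Q A g M v w where *: "frame Q A g M v" "matched A M v w" "card A + card Q = n"
      using Pn unfolding P_def by blast
    have "card Q \<le> CARD('n \<times> bool)" by (intro card_mono) auto
    then show ?thesis using card_less_N[OF *(1,2)] * by linarith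
  qed
  ultimately obtain n where "P n" and max: "\<And>n'. P n' \<Longrightarrow> n' \<le> n"
    by (metis GreatestI_nat Greatest_le_nat)
  then obtain Q A g M v w where fr: "frame Q A g M v" and m: "matched A M v w" and n: "card A + card Q = n"
    unfolding P_def by blast
  have maxD: "card A' + card Q' \<le> card A + card Q" if "frame Q' A' g' M' v'" "matched A' M' v' w'"
    for Q' A' g' M' v' w'
    using max that n unfolding P_def by blast
  have AN: "A \<subseteq> {..<N}" "finite A" using fr finite_subset unfolding frame_def by auto
  have free: "\<exists>w. matched A M v w \<and> k \<notin> w ` M" if k: "k \<in> {..<N} - A" for k
  proof -
    obtain U where U: "U \<subseteq> w ` M"
      and tight: "\<And>s. s \<in> M \<Longrightarrow> w s \<in> U \<Longrightarrow> {k. near (F k) (v s) s} \<inter> ({..<N} - A) \<subseteq> U"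
      and ex: "\<And>k. k \<in> {..<N} - A - U \<Longrightarrow> \<exists>w'. inj_on w' M \<and>
        (\<forall>s\<in>M. w' s \<in> {k. near (F k) (v s) s} \<inter> ({..<N} - A)) \<and> k \<notin> w' ` M"
      using unmatched_exchange[of "{..<N} - A" w M "\<lambda>s. {k. near (F k) (v s) s}"] m
      unfolding matched_def by (smt (verit) Int_iff finite_Diff finite_lessThan mem_Collect_eq)
    have "U = {}"
    proof (rule ccontr)
      assume "U \<noteq> {}"
      then obtain A' g' M' v' where "frame Q A' g' M' v'" "matched A' M' v' w" "card A < card A'"
        using select_tight[OF fr m U] tight by blast
      then show False using maxD by fastforce
    qed
    then show ?thesis using ex[of k] k unfolding matched_def by auto
  qed
  have Q: "Q = UNIV"
  proof (rule ccontr)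
    assume "Q \<noteq> UNIV"
    then obtain s where s: "s \<notin> Q" by blast
    then obtain M' v' w' where "frame (insert s Q) A g M' v'" "matched A M' v' w'"
      using extend_side[OF fr s m free] by blast
    from maxD[OF this] show False using s by simp
  qed
  have stable: "sol Q (insert k A) (g(k := K)) v = sol Q A g v" if k: "k \<in> {..<N} - A" "K \<in> F k" for k K
  proof (rule ccontr)
    assume ne: "sol Q (insert k A) (g(k := K)) v \<noteq> sol Q A g v"
    obtain w' where "matched A M v w'" "k \<notin> w' ` M" using free k by blast
    then have "frame Q (insert k A) (g(k := K)) M v" "matched (insert k A) M v w'"
      using select_merging[OF fr _ k(1) _ k(2) ne] by blast+
    from maxD[OF this] show False using k AN by simp
  qed
  obtain \<epsilon> where \<epsilon>: "\<epsilon> \<in> sol Q A g v"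
    using common_split[OF fr m, of A g] fr m unfolding frame_def matched_def sol_def by blast
  have goodA: "(\<forall>s. v s \<le> g k s) \<and> splits \<epsilon> (excl v (g k))" if "k \<in> A" for k
    using \<epsilon> that fr Q unfolding sol_def frame_def by auto
  have goodF: "(\<forall>s. v s \<le> K s) \<and> splits \<epsilon> (excl v K)" if k: "k \<in> {..<N} - A" "K \<in> F k" for k K
  proof -
    have "\<epsilon> \<in> sol Q (insert k A) (g(k := K)) v" using stable[OF k] \<epsilon> by simp
    then have "splits \<epsilon> (excl v K)" using Q unfolding sol_def by simp
    then show ?thesis using fr k Q unfolding frame_def by blast
  qed
  have "card A < N" using card_less_N[OF fr m] by simp
  then obtain i where i: "i \<in> {..<N} - A"
    using AN by (metis Diff_eq_empty_iff card_lessThan card_mono finite_lessThan ex_in_conv not_le)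
  \<comment> \<open>Any box may represent an unpicked colour, because by \<open>goodF\<close> all of
    them agree with the pattern.\<close>
  define G where "G k = (if k \<in> A then g k else (SOME K. K \<in> F k))" for k
  have G: "G k \<in> F k" if "k < N" for k
    using fr nonempty[OF that] unfolding frame_def G_def by (auto simp: some_in_eq)
  have "(\<forall>s. v s \<le> K s) \<and> splits \<epsilon> (excl v K)" if "K \<in> F i \<union> G ` ({..<N} - {i})" for K
    using that
  proof
    assume "K \<in> G ` ({..<N} - {i})"
    then obtain k where k: "k < N" "K = G k" by blast
    show ?thesis
    proof (cases "k \<in> A")
      case True
      then show ?thesis using goodA k unfolding G_def by simp
    next
      case False
      then show ?thesis using goodF[of k K] G k by simp
    qed
  qed (use goodF i in blast)
  then show ?thesis using i G by (intro exI[of _ i]) blast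
qed

end

section \<open>From endpoints back to boxes and points\<close>

lemma pierceable2_iff: "pierceable2 X \<longleftrightarrow> (\<exists>p q. \<forall>C\<in>X. p \<in> C \<or> q \<in> C)"
proof
  assume "pierceable2 X"
  then obtain P where P: "finite P" "card P \<le> 2" "\<forall>C\<in>X. C \<inter> P \<noteq> {}"
    unfolding pierceable2_def by blast
  have "\<exists>p q. P \<subseteq> {p, q}"
  proof -
    from P(2) consider "card P = 0" | "card P = 1" | "card P = 2" by linarith
    then show ?thesis
      using P(1) by cases (auto simp: card_1_singleton_iff card_2_iff)
  qed
  then show "\<exists>p q. \<forall>C\<in>X. p \<in> C \<or> q \<in> C" using P(3) by blast
next
  assume "\<exists>p q. \<forall>C\<in>X. p \<in> C \<or> q \<in> C"
  then obtain p q where "\<forall>C\<in>X. p \<in> C \<or> q \<in> C" by blast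
  then show "pierceable2 X"
    unfolding pierceable2_def by (intro exI[of _ "{p, q}"]) (auto simp: card_insert_if)
qed

text \<open>Compressing the line by \<open>arctan\<close> keeps the infima of endpoints finite.\<close>
lemma axis_box_sides:
  obtains sides :: "(real ^ 'n) set \<Rightarrow> 'n \<times> bool \<Rightarrow> real"
  where "\<And>B x. axis_box B \<Longrightarrow> x \<in> B \<longleftrightarrow> lies_in (\<lambda>j. arctan (x $ j)) (sides B)"
    and "\<And>B s. \<bar>sides B s\<bar> < pi / 2"
proof -
  have "\<forall>B. \<exists>e :: (real ^ 'n) \<times> (real ^ 'n). axis_box B \<longrightarrow>
      (\<forall>x. x \<in> B \<longleftrightarrow> (\<forall>j. fst e $ j \<le> x $ j \<and> x $ j \<le> snd e $ j))"
  proof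
    fix B :: "(real ^ 'n) set"
    show "\<exists>e. axis_box B \<longrightarrow> (\<forall>x. x \<in> B \<longleftrightarrow> (\<forall>j. fst e $ j \<le> x $ j \<and> x $ j \<le> snd e $ j))"
    proof (cases "axis_box B")
      case True
      then obtain lo hi where "B = {x. \<forall>j. lo $ j \<le> x $ j \<and> x $ j \<le> hi $ j}"
        unfolding axis_box_def by blast
      then show ?thesis by (intro exI[of _ "(lo, hi)"]) simp
    qed simp
  qed
  from choice[OF this] obtain e :: "(real ^ 'n) set \<Rightarrow> (real ^ 'n) \<times> (real ^ 'n)" where
    e: "\<forall>B. axis_box B \<longrightarrow> (\<forall>x. x \<in> B \<longleftrightarrow> (\<forall>j. fst (e B) $ j \<le> x $ j \<and> x $ j \<le> snd (e B) $ j))"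
    by blast
  define sides where "sides B s = (if snd s then arctan (snd (e B) $ fst s) else - arctan (fst (e B) $ fst s))"
    for B and s :: "'n \<times> bool"
  show thesis
  proof (rule that[of sides])
    show "x \<in> B \<longleftrightarrow> lies_in (\<lambda>j. arctan (x $ j)) (sides B)" if "axis_box B" for B x
      using e that by (simp add: lies_in_def sides_def arctan_le_iff)
    show "\<bar>sides B s\<bar> < pi / 2" for B s
      using arctan_bounded[of "snd (e B) $ fst s"] arctan_bounded[of "fst (e B) $ fst s"]
      unfolding sides_def by auto
  qed
qed

theorem theorem8:
  fixes F :: "nat \<Rightarrow> (real ^ 'n) set set"
  assumes boxes: "\<And>k. k < 3 * CARD('n) \<Longrightarrow> \<forall>B\<in>F k. axis_box B"
    and nonempty: "\<And>k. k < 3 * CARD('n) \<Longrightarrow> F k \<noteq> {}"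
    and colorful: "\<And>C. (\<forall>k < 3 * CARD('n). C k \<in> F k) \<Longrightarrow>
                     pierceable2 (C ` {..< 3 * CARD('n)})"
  shows "\<exists>i < 3 * CARD('n). \<exists>G. (\<forall>k < 3 * CARD('n). k \<noteq> i \<longrightarrow> G k \<in> F k) \<and>
           pierceable2 (F i \<union> G ` ({..< 3 * CARD('n)} - {i}))"
proof -
  define N where "N = 3 * CARD('n)"
  obtain sides :: "(real ^ 'n) set \<Rightarrow> 'n \<times> bool \<Rightarrow> real"
    where mem: "\<And>B x. axis_box B \<Longrightarrow> x \<in> B \<longleftrightarrow> lies_in (\<lambda>j. arctan (x $ j)) (sides B)"
      and bnd: "\<And>B s. \<bar>sides B s\<bar> < pi / 2"
    using axis_box_sides by blast
  interpret colourful_sides "\<lambda>k. sides ` F k" N "- (pi / 2)"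
  proof
    show "N = 3 * CARD('n)" by (rule N_def)
    show "sides ` F k \<noteq> {}" if "k < N" for k using nonempty that N_def by blast
    show "- (pi / 2) \<le> K s" if "k < N" "K \<in> sides ` F k" for k K s
    proof -
      from that(2) obtain B where "K = sides B" by blast
      then show ?thesis using bnd[of B s] by (simp add: abs_less_iff)
    qed
    fix C assume "\<And>k. k < N \<Longrightarrow> C k \<in> sides ` F k"
    then have "\<forall>k. \<exists>B. k < N \<longrightarrow> B \<in> F k \<and> C k = sides B" by blast
    then obtain D where D: "\<And>k. k < N \<Longrightarrow> D k \<in> F k" "\<And>k. k < N \<Longrightarrow> C k = sides (D k)" by metis
    then obtain p q where pq: "\<forall>B\<in>D ` {..<N}. p \<in> B \<or> q \<in> B"
      using colorful[of D] unfolding N_def pierceable2_iff by blast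
    have "\<exists>\<epsilon>. \<forall>k\<in>{..<N}. splits \<epsilon> (excl (\<lambda>s. Min ((\<lambda>k. C k s) ` {..<N})) (C k))"
    proof (rule splits_if_pierced)
      show "{..<N} \<noteq> {}" unfolding N_def by (simp add: lessThan_empty_iff)
      show "lies_in (\<lambda>j. arctan (p $ j)) (C k) \<or> lies_in (\<lambda>j. arctan (q $ j)) (C k)" if "k \<in> {..<N}" for k
        using pq that D mem[of "D k"] boxes[of k] unfolding N_def by auto
    qed simp
    then show "\<exists>\<epsilon>. \<forall>k<N. splits \<epsilon> (excl (\<lambda>s. Min ((\<lambda>k. C k s) ` {..<N})) (C k))" by blast
  qed
  obtain i G v \<epsilon> where i: "i < N" and G: "\<forall>k<N. k \<noteq> i \<longrightarrow> G k \<in> sides ` F k"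
    and split: "\<forall>K \<in> sides ` F i \<union> G ` ({..<N} - {i}). (\<forall>s. v s \<le> K s) \<and> splits \<epsilon> (excl v K)"
    using common_pattern by blast
  have "\<forall>k. \<exists>B. k < N \<and> k \<noteq> i \<longrightarrow> B \<in> F k \<and> G k = sides B" using G by blast
  then obtain H where H: "\<And>k. \<lbrakk>k < N; k \<noteq> i\<rbrakk> \<Longrightarrow> H k \<in> F k \<and> G k = sides (H k)" by metis
  define p where "p j = (if \<epsilon> j then v (j, True) else - v (j, False))" for j
  define q where "q j = (if \<epsilon> j then - v (j, False) else v (j, True))" for j
  \<comment> \<open>The compressed endpoints lie strictly between \<open>- (pi / 2)\<close> and
    \<open>pi / 2\<close>, hence so does \<open>r\<close>, and \<open>tan\<close> undoes the
    compression.\<close>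
  have realise: "(\<chi> j. tan (r j)) \<in> B" if "axis_box B" "lies_in r (sides B)" for r B
  proof -
    have "arctan (tan (r j)) = r j" for j
    proof (rule arctan_tan)
      show "- (pi / 2) < r j" "r j < pi / 2"
        using that(2) bnd[of B "(j, True)"] bnd[of B "(j, False)"] unfolding lies_in_def
        by (smt (verit))+
    qed
    then show ?thesis using mem[OF that(1)] that(2) by simp
  qed
  have "(\<chi> j. tan (p j)) \<in> B \<or> (\<chi> j. tan (q j)) \<in> B" if "B \<in> F i \<union> H ` ({..<N} - {i})" for B
  proof -
    have "axis_box B" using that H i boxes unfolding N_def by blast
    moreover have "sides B \<in> sides ` F i \<union> G ` ({..<N} - {i})" using that H by fastforce
    then have "lies_in p (sides B) \<or> lies_in q (sides B)"
      using split pierced_if_splits[of \<epsilon> v "sides B"] unfolding p_def q_def by blast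
    ultimately show ?thesis using realise by blast
  qed
  then have "pierceable2 (F i \<union> H ` ({..<N} - {i}))" unfolding pierceable2_iff by blast
  then show ?thesis using i H unfolding N_def by blast
qed

end
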